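(* Let $(\mathcal{M},\phi,\xi,\eta,g)$ be a Riemannian $\Pi$-manifold with Levi-Civita connection $\nabla$ and fundamental tensor $F(x,y,z)=g\bigl((\nabla_x\phi)y,z\bigr)$. Let $D$ be an affine connection on $\mathcal{M}$ and let $Q$ be its potential with respect to $\nabla$, i.e. $D_xy=\nabla_xy+Q(x,y)$, with corresponding $(0,3)$-tensor $Q(x,y,z)=g(Q(x,y),z)$. Then $D$ is a natural connection on $(\mathcal{M},\phi,\xi,\eta,g)$ if and only if, for all vector fields $x,y,z$ on $\mathcal{M}$, $$Q(x,y,\phi z)-Q(x,\phi y,z)=F(x,y,z),\qquad Q(x,y,z)=-Q(x,z,y).$$
   Context: A Riemannian $\Pi$-manifold $(\mathcal{M},\phi,\xi,\eta,g)$ is a $(2n+1)$-dimensional smooth manifold $\mathcal{M}$ with a Riemannian metric $g$, a $(1,1)$-tensor field $\phi$, a vector field $\xi$ and a 1-form $\eta$ such that $$\phi\xi=0,\quad \phi^2=I-\eta\otimes\xi,\quad \eta\circ\phi=0,\quad \eta(\xi)=1,\quad \operatorname{tr}\phi=0,\quad g(\phi x,\phi y)=g(x,y)-\eta(x)\eta(y).$$ Consequently $g(\phi x,y)=g(x,\phi y)$ and $g(x,\xi)=\eta(x)$. An affine connection $D$ on a Riemannian $\Pi$-manifold is called a natural connection if $D\phi=0$, $D\xi=0$, $D\eta=0$ and $Dg=0$. *)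

theory Defs
  imports "HOL-Analysis.Analysis" "HOL-Library.Function_Algebras"
begin

subsection \<open>Pointwise real vector space structure on functions\<close>

instantiation "fun" :: (type, real_vector) real_vector
begin

definition scaleR_fun :: "real \<Rightarrow> ('a \<Rightarrow> 'b) \<Rightarrow> 'a \<Rightarrow> 'b"
  where "scaleR_fun c f = (\<lambda>x. c *\<^sub>R f x)"

instance
  by standard (simp_all add: scaleR_fun_def plus_fun_def fun_eq_iff scaleR_add_right scaleR_add_left)

end

definition linear_on :: "'v::real_vector set \<Rightarrow> ('v \<Rightarrow> 'w::real_vector) \<Rightarrow> bool"
  where "linear_on V L \<longleftrightarrow>
    (\<forall>v\<in>V. \<forall>w\<in>V. L (v + w) = L v + L w) \<and> (\<forall>c. \<forall>v\<in>V. L (c *\<^sub>R v) = c *\<^sub>R L v)"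

text \<open>The trace of an endomorphism of a finite-dimensional subspace; it does not depend on the
  chosen basis.\<close>

definition trace_on :: "'v::real_vector set \<Rightarrow> ('v \<Rightarrow> 'v) \<Rightarrow> real"
  where "trace_on V L =
    (let B = (SOME B. independent B \<and> span B = V) in \<Sum>b\<in>B. representation B (L b) b)"


subsection \<open>Smooth maps between Euclidean spaces\<close>

text \<open>These notions are meant for open sets \<open>S\<close>: order \<open>k\<close> means that all iterated directional
  derivatives up to order \<open>k\<close> exist and are continuous on \<open>S\<close>.\<close>

primrec Ck_on :: "nat \<Rightarrow> 'e::euclidean_space set \<Rightarrow> ('e \<Rightarrow> 'f::euclidean_space) \<Rightarrow> bool"
  where
    "Ck_on 0 S f \<longleftrightarrow> continuous_on S f"
  | "Ck_on (Suc k) S f \<longleftrightarrow>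
      (\<forall>x\<in>S. f differentiable (at x)) \<and> (\<forall>v. Ck_on k S (\<lambda>x. frechet_derivative f (at x) v))"

definition smooth_on :: "'e::euclidean_space set \<Rightarrow> ('e \<Rightarrow> 'f::euclidean_space) \<Rightarrow> bool"
  where "smooth_on S f \<longleftrightarrow> (\<forall>k. Ck_on k S f)"


subsection \<open>Smooth manifolds\<close>

text \<open>A manifold is given by a topology and an atlas of charts \<open>(U, \<psi>)\<close>; its points form the set
  \<open>topspace (mtop M)\<close>, a subset of the type \<open>'a\<close>. The atlas need not be maximal.\<close>

record ('a, 'e) mfd =
  mtop :: "'a topology"
  charts :: "('a set \<times> ('a \<Rightarrow> 'e)) set"

abbreviation points :: "('a, 'e) mfd \<Rightarrow> 'a set"
  where "points M \<equiv> topspace (mtop M)"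

definition chart_on :: "'a topology \<Rightarrow> 'a set \<Rightarrow> ('a \<Rightarrow> 'e::euclidean_space) \<Rightarrow> bool"
  where "chart_on T U \<psi> \<longleftrightarrow> openin T U \<and> open (\<psi> ` U) \<and>
    homeomorphic_map (subtopology T U) (top_of_set (\<psi> ` U)) \<psi>"

definition smooth_manifold :: "('a, 'e::euclidean_space) mfd \<Rightarrow> bool"
  where "smooth_manifold M \<longleftrightarrow>
    Hausdorff_space (mtop M) \<and> second_countable (mtop M) \<and>
    (\<forall>(U, \<psi>)\<in>charts M. chart_on (mtop M) U \<psi>) \<and>
    (\<Union>(U, \<psi>)\<in>charts M. U) = points M \<and>
    (\<forall>(U, \<psi>)\<in>charts M. \<forall>(V, \<psi>')\<in>charts M. smooth_on (\<psi> ` (U \<inter> V)) (\<psi>' \<circ> inv_into U \<psi>))"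

text \<open>Functions on the manifold, and below vector fields and tensor fields, are represented by total
  functions on the type \<open>'a\<close>. So that equality of fields is equality of functions, they are all
  normalised to vanish off \<open>points M\<close>.\<close>

definition smooth_functions :: "('a, 'e::euclidean_space) mfd \<Rightarrow> ('a \<Rightarrow> real) set"
  where "smooth_functions M = {f.
    (\<forall>p. p \<notin> points M \<longrightarrow> f p = 0) \<and>
    (\<forall>(U, \<psi>)\<in>charts M. smooth_on (\<psi> ` U) (f \<circ> inv_into U \<psi>))}"

text \<open>Tangent vectors at \<open>p\<close> are the derivations at \<open>p\<close> of the algebra of smooth functions; as
  total functions they are normalised to vanish on non-smooth arguments.\<close>

type_synonym 'a tangent = "('a \<Rightarrow> real) \<Rightarrow> real"
type_synonym 'a vfield = "'a \<Rightarrow> 'a tangent"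

definition tangent_space :: "('a, 'e::euclidean_space) mfd \<Rightarrow> 'a \<Rightarrow> 'a tangent set"
  where "tangent_space M p = {v.
    linear_on (smooth_functions M) v \<and>
    (\<forall>f\<in>smooth_functions M. \<forall>h\<in>smooth_functions M. v (f * h) = f p * v h + h p * v f) \<and>
    (\<forall>f. f \<notin> smooth_functions M \<longrightarrow> v f = 0)}"


subsection \<open>Vector fields and tensor fields\<close>

definition vf_deriv :: "'a vfield \<Rightarrow> ('a \<Rightarrow> real) \<Rightarrow> 'a \<Rightarrow> real"
  where "vf_deriv X f = (\<lambda>p. X p f)"

definition vf_scale :: "('a \<Rightarrow> real) \<Rightarrow> 'a vfield \<Rightarrow> 'a vfield"
  where "vf_scale f X = (\<lambda>p. f p *\<^sub>R X p)"

definition vector_fields :: "('a, 'e::euclidean_space) mfd \<Rightarrow> 'a vfield set"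
  where "vector_fields M = {X.
    (\<forall>p\<in>points M. X p \<in> tangent_space M p) \<and>
    (\<forall>p. p \<notin> points M \<longrightarrow> X p = 0) \<and>
    (\<forall>f\<in>smooth_functions M. vf_deriv X f \<in> smooth_functions M)}"

definition lie_bracket :: "'a vfield \<Rightarrow> 'a vfield \<Rightarrow> 'a vfield"
  where "lie_bracket X Y = (\<lambda>p f. X p (vf_deriv Y f) - Y p (vf_deriv X f))"

text \<open>Tensor fields are families of (multi)linear maps on the tangent spaces. They are smooth if they
  send smooth vector fields to smooth fields.\<close>

definition tapp :: "('a \<Rightarrow> 'a tangent \<Rightarrow> 'b) \<Rightarrow> 'a vfield \<Rightarrow> 'a \<Rightarrow> 'b"
  where "tapp T X = (\<lambda>p. T p (X p))"

definition tapp2 :: "('a \<Rightarrow> 'a tangent \<Rightarrow> 'a tangent \<Rightarrow> real) \<Rightarrow> 'a vfield \<Rightarrow> 'a vfield \<Rightarrow> 'a \<Rightarrow> real"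
  where "tapp2 g X Y = (\<lambda>p. g p (X p) (Y p))"

definition one_form :: "('a, 'e::euclidean_space) mfd \<Rightarrow> ('a \<Rightarrow> 'a tangent \<Rightarrow> real) \<Rightarrow> bool"
  where "one_form M \<eta> \<longleftrightarrow>
    (\<forall>p\<in>points M. linear_on (tangent_space M p) (\<eta> p)) \<and>
    (\<forall>p. p \<notin> points M \<longrightarrow> \<eta> p = 0) \<and>
    (\<forall>X\<in>vector_fields M. tapp \<eta> X \<in> smooth_functions M)"

definition tensor11 :: "('a, 'e::euclidean_space) mfd \<Rightarrow> ('a \<Rightarrow> 'a tangent \<Rightarrow> 'a tangent) \<Rightarrow> bool"
  where "tensor11 M \<phi> \<longleftrightarrow>
    (\<forall>p\<in>points M. linear_on (tangent_space M p) (\<phi> p) \<and>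
       (\<forall>v\<in>tangent_space M p. \<phi> p v \<in> tangent_space M p)) \<and>
    (\<forall>p. p \<notin> points M \<longrightarrow> \<phi> p = 0) \<and>
    (\<forall>X\<in>vector_fields M. tapp \<phi> X \<in> vector_fields M)"

definition riemannian_metric ::
    "('a, 'e::euclidean_space) mfd \<Rightarrow> ('a \<Rightarrow> 'a tangent \<Rightarrow> 'a tangent \<Rightarrow> real) \<Rightarrow> bool"
  where "riemannian_metric M g \<longleftrightarrow>
    (\<forall>p\<in>points M.
       (\<forall>v\<in>tangent_space M p. linear_on (tangent_space M p) (g p v)) \<and>
       (\<forall>v\<in>tangent_space M p. \<forall>w\<in>tangent_space M p. g p v w = g p w v) \<and>
       (\<forall>v\<in>tangent_space M p. v \<noteq> 0 \<longrightarrow> g p v v > 0)) \<and>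
    (\<forall>p. p \<notin> points M \<longrightarrow> g p = 0) \<and>
    (\<forall>X\<in>vector_fields M. \<forall>Y\<in>vector_fields M. tapp2 g X Y \<in> smooth_functions M)"


subsection \<open>Affine connections\<close>

text \<open>\<open>D X Y\<close> stands for $D_X Y$; only its values on vector fields matter.\<close>

definition affine_connection ::
    "('a, 'e::euclidean_space) mfd \<Rightarrow> ('a vfield \<Rightarrow> 'a vfield \<Rightarrow> 'a vfield) \<Rightarrow> bool"
  where "affine_connection M D \<longleftrightarrow>
    (\<forall>X\<in>vector_fields M. \<forall>Y\<in>vector_fields M. D X Y \<in> vector_fields M) \<and>
    (\<forall>X\<in>vector_fields M. \<forall>Y\<in>vector_fields M. \<forall>Z\<in>vector_fields M.
       D (X + Y) Z = D X Z + D Y Z \<and> D X (Y + Z) = D X Y + D X Z) \<and>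
    (\<forall>f\<in>smooth_functions M. \<forall>X\<in>vector_fields M. \<forall>Y\<in>vector_fields M.
       D (vf_scale f X) Y = vf_scale f (D X Y) \<and>
       D X (vf_scale f Y) = vf_scale (vf_deriv X f) Y + vf_scale f (D X Y))"

text \<open>Covariant derivatives of a (1,1)-tensor field, a 1-form and a (0,2)-tensor field: these are
  $(D_X\phi)Y$, $(D_X\eta)Y$ and $(D_X g)(Y,Z)$.\<close>

definition cov_tensor11 ::
    "('a vfield \<Rightarrow> 'a vfield \<Rightarrow> 'a vfield) \<Rightarrow> ('a \<Rightarrow> 'a tangent \<Rightarrow> 'a tangent)
      \<Rightarrow> 'a vfield \<Rightarrow> 'a vfield \<Rightarrow> 'a vfield"
  where "cov_tensor11 D \<phi> X Y = D X (tapp \<phi> Y) - tapp \<phi> (D X Y)"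

definition cov_one_form ::
    "('a vfield \<Rightarrow> 'a vfield \<Rightarrow> 'a vfield) \<Rightarrow> ('a \<Rightarrow> 'a tangent \<Rightarrow> real)
      \<Rightarrow> 'a vfield \<Rightarrow> 'a vfield \<Rightarrow> 'a \<Rightarrow> real"
  where "cov_one_form D \<eta> X Y = vf_deriv X (tapp \<eta> Y) - tapp \<eta> (D X Y)"

definition cov_metric ::
    "('a vfield \<Rightarrow> 'a vfield \<Rightarrow> 'a vfield) \<Rightarrow> ('a \<Rightarrow> 'a tangent \<Rightarrow> 'a tangent \<Rightarrow> real)
      \<Rightarrow> 'a vfield \<Rightarrow> 'a vfield \<Rightarrow> 'a vfield \<Rightarrow> 'a \<Rightarrow> real"
  where "cov_metric D g X Y Z =
    vf_deriv X (tapp2 g Y Z) - tapp2 g (D X Y) Z - tapp2 g Y (D X Z)"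

definition levi_civita ::
    "('a, 'e::euclidean_space) mfd \<Rightarrow> ('a \<Rightarrow> 'a tangent \<Rightarrow> 'a tangent \<Rightarrow> real)
      \<Rightarrow> ('a vfield \<Rightarrow> 'a vfield \<Rightarrow> 'a vfield) \<Rightarrow> bool"
  where "levi_civita M g D \<longleftrightarrow> affine_connection M D \<and>
    (\<forall>X\<in>vector_fields M. \<forall>Y\<in>vector_fields M. D X Y - D Y X = lie_bracket X Y) \<and>
    (\<forall>X\<in>vector_fields M. \<forall>Y\<in>vector_fields M. \<forall>Z\<in>vector_fields M. cov_metric D g X Y Z = 0)"


subsection \<open>Riemannian \<open>\<Pi>\<close>-manifolds\<close>

locale riemannian_Pi_manifold =
  fixes M :: "('a, 'e::euclidean_space) mfd"
    and n :: nat
    and \<phi> :: "'a \<Rightarrow> 'a tangent \<Rightarrow> 'a tangent"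
    and \<xi> :: "'a vfield"
    and \<eta> :: "'a \<Rightarrow> 'a tangent \<Rightarrow> real"
    and g :: "'a \<Rightarrow> 'a tangent \<Rightarrow> 'a tangent \<Rightarrow> real"
  assumes manifold: "smooth_manifold M"
    and dimension: "DIM('e) = 2 * n + 1"
    and metric: "riemannian_metric M g"
    and tensor: "tensor11 M \<phi>"
    and field: "\<xi> \<in> vector_fields M"
    and form: "one_form M \<eta>"
    and phi_xi: "\<And>p. p \<in> points M \<Longrightarrow> \<phi> p (\<xi> p) = 0"
    and phi_phi: "\<And>p v. p \<in> points M \<Longrightarrow> v \<in> tangent_space M p \<Longrightarrow>
      \<phi> p (\<phi> p v) = v - \<eta> p v *\<^sub>R \<xi> p"
    and eta_phi: "\<And>p v. p \<in> points M \<Longrightarrow> v \<in> tangent_space M p \<Longrightarrow> \<eta> p (\<phi> p v) = 0"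
    and eta_xi: "\<And>p. p \<in> points M \<Longrightarrow> \<eta> p (\<xi> p) = 1"
    and trace_phi: "\<And>p. p \<in> points M \<Longrightarrow> trace_on (tangent_space M p) (\<phi> p) = 0"
    and metric_phi: "\<And>p v w. p \<in> points M \<Longrightarrow> v \<in> tangent_space M p \<Longrightarrow> w \<in> tangent_space M p \<Longrightarrow>
      g p (\<phi> p v) (\<phi> p w) = g p v w - \<eta> p v * \<eta> p w"

definition natural_connection ::
    "('a, 'e::euclidean_space) mfd \<Rightarrow> ('a \<Rightarrow> 'a tangent \<Rightarrow> 'a tangent) \<Rightarrow> 'a vfield
      \<Rightarrow> ('a \<Rightarrow> 'a tangent \<Rightarrow> real) \<Rightarrow> ('a \<Rightarrow> 'a tangent \<Rightarrow> 'a tangent \<Rightarrow> real)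
      \<Rightarrow> ('a vfield \<Rightarrow> 'a vfield \<Rightarrow> 'a vfield) \<Rightarrow> bool"
  where "natural_connection M \<phi> \<xi> \<eta> g D \<longleftrightarrow> affine_connection M D \<and>
    (\<forall>X\<in>vector_fields M. \<forall>Y\<in>vector_fields M. cov_tensor11 D \<phi> X Y = 0) \<and>
    (\<forall>X\<in>vector_fields M. D X \<xi> = 0) \<and>
    (\<forall>X\<in>vector_fields M. \<forall>Y\<in>vector_fields M. cov_one_form D \<eta> X Y = 0) \<and>
    (\<forall>X\<in>vector_fields M. \<forall>Y\<in>vector_fields M. \<forall>Z\<in>vector_fields M. cov_metric D g X Y Z = 0)"

text \<open>$F(X,Y,Z) = g((\nabla_X\phi)Y, Z)$.\<close>

definition fundamental_tensor ::
    "('a \<Rightarrow> 'a tangent \<Rightarrow> 'a tangent \<Rightarrow> real) \<Rightarrow> ('a vfield \<Rightarrow> 'a vfield \<Rightarrow> 'a vfield)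
      \<Rightarrow> ('a \<Rightarrow> 'a tangent \<Rightarrow> 'a tangent) \<Rightarrow> 'a vfield \<Rightarrow> 'a vfield \<Rightarrow> 'a vfield \<Rightarrow> 'a \<Rightarrow> real"
  where "fundamental_tensor g nabla \<phi> X Y Z = tapp2 g (cov_tensor11 nabla \<phi> X Y) Z"

text \<open>The (0,3)-tensor $Q(X,Y,Z) = g(Q(X,Y),Z)$ of a vector-valued \<open>Q\<close>.\<close>

definition lower3 ::
    "('a \<Rightarrow> 'a tangent \<Rightarrow> 'a tangent \<Rightarrow> real) \<Rightarrow> ('a vfield \<Rightarrow> 'a vfield \<Rightarrow> 'a vfield)
      \<Rightarrow> 'a vfield \<Rightarrow> 'a vfield \<Rightarrow> 'a vfield \<Rightarrow> 'a \<Rightarrow> real"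
  where "lower3 g Q X Y Z = tapp2 g (Q X Y) Z"

end

theory Submission
  imports Defs
begin

text \<open>Write \<open>Q = D - \<nabla>\<close>. Self-adjointness of \<open>\<phi>\<close> turns the first condition into \<open>g((D\<^sub>x\<phi>)y, z) = 0\<close>,
  and \<open>\<nabla>g = 0\<close> turns the second one into \<open>Dg = 0\<close>; taking \<open>z = (D\<^sub>x\<phi>)y\<close> gives \<open>D\<phi> = 0\<close>. The
  remaining two conditions of naturality are then automatic: \<open>\<phi>(D\<^sub>x\<xi>) = D\<^sub>x(\<phi>\<xi>) = 0\<close> makes \<open>D\<^sub>x\<xi>\<close> a
  multiple of \<open>\<xi>\<close>, which vanishes because \<open>g(\<xi>, \<xi>) = 1\<close> is constant, and \<open>D\<eta> = 0\<close> since
  \<open>\<eta> = g(\<xi>, \<sqdot>)\<close>.\<close>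

section \<open>Smooth functions and vector fields are closed under differences\<close>

lemma Ck_on_cong:
  assumes "open S" "\<And>x. x \<in> S \<Longrightarrow> f x = h x" "Ck_on k S f"
  shows "Ck_on k S h"
  using assms(2,3)
proof (induction k arbitrary: f h)
  case 0
  then show ?case by (simp cong: continuous_on_cong)
next
  case (Suc k)
  have d: "f differentiable at x" if "x \<in> S" for x
    using Suc.prems(2) that by simp
  have "h differentiable at x" if "x \<in> S" for x
  proof -
    from d[OF that] obtain D where "(f has_derivative D) (at x)"
      unfolding differentiable_def ..
    from has_derivative_transform_within_open[OF this \<open>open S\<close> that] Suc.prems(1) show ?thesis
      unfolding differentiable_def by blast
  qed
  \<comment> \<open>As \<open>S\<close> is open, \<open>f\<close> and \<open>h\<close> agree near
    each of its points, so their derivatives agree on \<open>S\<close>; the induction hypothesis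
    applies to these in place of \<open>f\<close> and \<open>h\<close>.\<close>
  moreover have "Ck_on k S (\<lambda>x. frechet_derivative h (at x) v)" for v
  proof (rule Suc.IH)
    show "Ck_on k S (\<lambda>x. frechet_derivative f (at x) v)"
      using Suc.prems(2) by simp
    show "frechet_derivative f (at x) v = frechet_derivative h (at x) v" if "x \<in> S" for x
      using frechet_derivative_transform_within_open[OF d[OF that] \<open>open S\<close> that Suc.prems(1)]
      by simp
  qed
  ultimately show ?case by simp
qed

lemma Ck_on_diff:
  assumes "open S" "Ck_on k S f" "Ck_on k S h"
  shows "Ck_on k S (\<lambda>x. f x - h x)"
  using assms(2,3)
proof (induction k arbitrary: f h)
  case 0
  then show ?case by (simp add: continuous_on_diff)
next
  case (Suc k)
  have d: "f differentiable at x" "h differentiable at x" if "x \<in> S" for x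
    using Suc.prems that by simp_all
  have "Ck_on k S (\<lambda>x. frechet_derivative (\<lambda>x. f x - h x) (at x) v)" for v
  \<comment> \<open>Differentiation is known to commute with the difference only at points of
    \<open>S\<close>, hence the detour through congruence.\<close>
  proof (rule Ck_on_cong[OF \<open>open S\<close>])
    show "Ck_on k S (\<lambda>x. frechet_derivative f (at x) v - frechet_derivative h (at x) v)"
      using Suc by simp
    show "frechet_derivative f (at x) v - frechet_derivative h (at x) v
        = frechet_derivative (\<lambda>x. f x - h x) (at x) v" if "x \<in> S" for x
      using has_derivative_diff[OF d[OF that, unfolded frechet_derivative_works]]
      by (metis frechet_derivative_at)
  qed
  with d show ?case by simp
qed

lemma smooth_functions_diff:
  assumes "smooth_manifold M" "f \<in> smooth_functions M" "h \<in> smooth_functions M"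
  shows "f - h \<in> smooth_functions M"
proof -
  have "smooth_on (\<psi> ` U) ((f - h) \<circ> inv_into U \<psi>)" if c: "(U, \<psi>) \<in> charts M" for U \<psi>
  proof -
    have "open (\<psi> ` U)"
      using assms(1) c by (auto simp: smooth_manifold_def chart_on_def)
    moreover have "smooth_on (\<psi> ` U) (f \<circ> inv_into U \<psi>)" "smooth_on (\<psi> ` U) (h \<circ> inv_into U \<psi>)"
      using assms(2,3) c by (auto simp: smooth_functions_def)
    moreover have "(f - h) \<circ> inv_into U \<psi>
        = (\<lambda>x. (f \<circ> inv_into U \<psi>) x - (h \<circ> inv_into U \<psi>) x)"
      by auto
    ultimately show ?thesis
      unfolding smooth_on_def by (metis Ck_on_diff)
  qed
  with assms(2,3) show ?thesis
    by (auto simp: smooth_functions_def)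
qed

lemma tangent_space_diff:
  assumes "v \<in> tangent_space M p" "w \<in> tangent_space M p"
  shows "v - w \<in> tangent_space M p"
  using assms by (simp add: tangent_space_def linear_on_def algebra_simps)

lemma tangent_space_scale: "v \<in> tangent_space M p \<Longrightarrow> c *\<^sub>R v \<in> tangent_space M p"
  by (simp add: tangent_space_def linear_on_def scaleR_fun_def algebra_simps)

text \<open>Used for \<open>D x y - nabla x y\<close> and for the covariant derivative of
  \<open>\<phi>\<close>, itself a difference of fields, which is later paired with itself under
  \<open>g\<close>.\<close>

lemma vector_fields_diff:
  assumes "smooth_manifold M" "X \<in> vector_fields M" "Y \<in> vector_fields M"
  shows "X - Y \<in> vector_fields M"
proof -
  have "vf_deriv (X - Y) f = vf_deriv X f - vf_deriv Y f" for f
    by (auto simp: vf_deriv_def)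
  with assms show ?thesis
    by (auto simp: vector_fields_def intro: smooth_functions_diff tangent_space_diff)
qed

lemma vector_fields_zero:
  assumes "smooth_manifold M" "X \<in> vector_fields M"
  shows "0 \<in> vector_fields M"
  using vector_fields_diff[OF assms(1,2,2)] by simp

lemma vector_field_tangent: "X \<in> vector_fields M \<Longrightarrow> p \<in> points M \<Longrightarrow> X p \<in> tangent_space M p"
  by (simp add: vector_fields_def)

lemma vector_field_eqI:
  assumes "X \<in> vector_fields M" "Y \<in> vector_fields M" "\<And>p. p \<in> points M \<Longrightarrow> X p = Y p"
  shows "X = Y"
proof
  show "X p = Y p" for p
    using assms by (cases "p \<in> points M") (simp_all add: vector_fields_def)
qed

text \<open>Additivity is applied to \<open>v - w\<close> and \<open>w\<close>; as \<open>V\<close>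
  is an arbitrary set, membership of \<open>v - w\<close> is a hypothesis.\<close>

lemma linear_on_diff:
  assumes "linear_on V L" "v \<in> V" "w \<in> V" "v - w \<in> V"
  shows "L (v - w) = L v - L w"
proof -
  have "L (v - w + w) = L (v - w) + L w"
    using assms unfolding linear_on_def by blast
  then show ?thesis by simp
qed

lemma affine_connection_closed:
  assumes "affine_connection M D" "X \<in> vector_fields M" "Y \<in> vector_fields M"
  shows "D X Y \<in> vector_fields M"
  using assms by (simp add: affine_connection_def)

lemma affine_connection_zero:
  assumes "smooth_manifold M" "affine_connection M D" "X \<in> vector_fields M"
  shows "D X 0 = 0"
proof -
  have "D X (0 + 0) = D X 0 + D X 0"
    using assms vector_fields_zero unfolding affine_connection_def by blast
  then show ?thesis by simp
qed

text \<open>The constant function one is encoded as the indicator function of \<open>points M\<close>, since smooth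
  functions vanish off \<open>points M\<close>.\<close>

lemma vf_deriv_one:
  assumes "X \<in> vector_fields M" "f \<in> smooth_functions M" "\<And>p. p \<in> points M \<Longrightarrow> f p = 1"
    and "p \<in> points M"
  shows "vf_deriv X f p = 0"
proof -
  \<comment> \<open>By idempotence the Leibniz rule at a point with \<open>f p = 1\<close> reads
    \<open>X p f = 2 * X p f\<close>.\<close>
  have "f * f = f"
  proof
    show "(f * f) p = f p" for p
      using assms(2,3) by (cases "p \<in> points M") (simp_all add: smooth_functions_def)
  qed
  moreover have "X p (f * f) = f p * X p f + f p * X p f"
    using vector_field_tangent[OF assms(1,4)] assms(2) by (simp add: tangent_space_def)
  ultimately show ?thesis
    using assms(3,4) by (simp add: vf_deriv_def)
qed

section \<open>Pointwise algebra of the structure tensors\<close>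

context riemannian_Pi_manifold
begin

lemma phi_closed: "X \<in> vector_fields M \<Longrightarrow> tapp \<phi> X \<in> vector_fields M"
  using tensor by (simp add: tensor11_def)

lemma phi_tangent: "p \<in> points M \<Longrightarrow> v \<in> tangent_space M p \<Longrightarrow> \<phi> p v \<in> tangent_space M p"
  using tensor by (simp add: tensor11_def)

lemma phi_diff:
  assumes "p \<in> points M" "v \<in> tangent_space M p" "w \<in> tangent_space M p"
  shows "\<phi> p (v - w) = \<phi> p v - \<phi> p w"
  using tensor assms by (simp add: tensor11_def linear_on_diff[of "tangent_space M p"] tangent_space_diff)

lemma tapp_phi_xi: "tapp \<phi> \<xi> = 0"
proof
  show "tapp \<phi> \<xi> p = 0 p" for p
    using tensor by (cases "p \<in> points M") (simp_all add: tapp_def tensor11_def phi_xi)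
qed

lemma metric_sym:
  "p \<in> points M \<Longrightarrow> v \<in> tangent_space M p \<Longrightarrow> w \<in> tangent_space M p \<Longrightarrow> g p v w = g p w v"
  using metric by (simp add: riemannian_metric_def)

lemma metric_diff_right:
  assumes "p \<in> points M" "u \<in> tangent_space M p" "v \<in> tangent_space M p" "w \<in> tangent_space M p"
  shows "g p u (v - w) = g p u v - g p u w"
  using metric assms
  by (simp add: riemannian_metric_def linear_on_diff[of "tangent_space M p"] tangent_space_diff)

lemma metric_diff_left:
  assumes "p \<in> points M" "u \<in> tangent_space M p" "v \<in> tangent_space M p" "w \<in> tangent_space M p"
  shows "g p (v - w) u = g p v u - g p w u"
  using metric_diff_right[OF assms] assms
  by (simp add: metric_sym[of p _ u] tangent_space_diff)

lemma metric_zero_left: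
  assumes "p \<in> points M" "u \<in> tangent_space M p"
  shows "g p 0 u = 0"
  using metric_diff_left[OF assms assms(2,2)] by simp

lemma metric_scale_left:
  assumes "p \<in> points M" "u \<in> tangent_space M p" "v \<in> tangent_space M p"
  shows "g p (c *\<^sub>R v) u = c * g p v u"
proof -
  have "g p u (c *\<^sub>R v) = c * g p u v"
    using metric assms by (simp add: riemannian_metric_def linear_on_def)
  with assms show ?thesis by (simp add: metric_sym[of p _ u] tangent_space_scale)
qed

lemma metric_off_points: "p \<notin> points M \<Longrightarrow> g p v w = 0"
  using metric by (simp add: riemannian_metric_def)

lemma metric_definite:
  assumes "p \<in> points M" "v \<in> tangent_space M p" "g p v v = 0"
  shows "v = 0"
proof (rule ccontr)
  assume "v \<noteq> 0"
  with metric assms(1,2) have "g p v v > 0"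
    by (simp add: riemannian_metric_def)
  with assms(3) show False by simp
qed

lemma xi_tangent: "p \<in> points M \<Longrightarrow> \<xi> p \<in> tangent_space M p"
  by (rule vector_field_tangent[OF field])

text \<open>Putting \<open>\<xi>\<close> into the compatibility of \<open>g\<close> and
  \<open>\<phi>\<close> makes the left side vanish, since \<open>\<phi>\<close> kills
  \<open>\<xi>\<close>, and turns the correction term into \<open>\<eta> p v\<close>.\<close>

lemma metric_xi:
  assumes "p \<in> points M" "v \<in> tangent_space M p"
  shows "g p (\<xi> p) v = \<eta> p v"
  using metric_phi[OF assms(1) xi_tangent assms(2)] assms
  by (simp add: phi_xi eta_xi metric_zero_left phi_tangent)

lemma tapp_eta: "X \<in> vector_fields M \<Longrightarrow> tapp \<eta> X = tapp2 g \<xi> X"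
proof
  fix p assume X: "X \<in> vector_fields M"
  have "\<eta> p = 0" if "p \<notin> points M"
    using form that by (simp add: one_form_def)
  then show "tapp \<eta> X p = tapp2 g \<xi> X p"
    using X by (cases "p \<in> points M")
      (simp_all add: tapp_def tapp2_def metric_xi vector_field_tangent metric_off_points)
qed

lemma phi_self_adjoint:
  assumes "p \<in> points M" "v \<in> tangent_space M p" "w \<in> tangent_space M p"
  shows "g p (\<phi> p v) w = g p v (\<phi> p w)"
proof -
  note [simp] = assms phi_tangent xi_tangent
  \<comment> \<open>Compatibility for the pair \<open>\<phi> p v\<close>, \<open>w\<close> has no
    correction term because \<open>\<eta>\<close> vanishes on the image of
    \<open>\<phi>\<close>.\<close>
  have "g p (\<phi> p v) w = g p (\<phi> p (\<phi> p v)) (\<phi> p w)"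
    by (simp add: metric_phi eta_phi)
  \<comment> \<open>The square of \<open>\<phi>\<close> differs from the identity by a multiple of
    \<open>\<xi>\<close>, which is orthogonal to the image of \<open>\<phi>\<close>.\<close>
  also have "\<dots> = g p v (\<phi> p w)"
    by (simp add: phi_phi metric_diff_left metric_scale_left tangent_space_scale metric_xi eta_phi)
  finally show ?thesis .
qed

section \<open>From pointwise identities to identities of fields\<close>

text \<open>Testing against \<open>X\<close> itself suffices, so no tangent vector has to be
  extended to a global field.\<close>

lemma metric_zero_field:
  assumes "X \<in> vector_fields M" "\<And>Z. Z \<in> vector_fields M \<Longrightarrow> tapp2 g X Z = 0"
  shows "X = 0"
proof (rule vector_field_eqI[OF assms(1) vector_fields_zero[OF manifold field]])
  fix p assume "p \<in> points M"
  moreover have "g p (X p) (X p) = 0"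
    using assms(2)[OF assms(1)] by (simp add: tapp2_def fun_eq_iff)
  ultimately show "X p = 0 p"
    using metric_definite vector_field_tangent[OF assms(1)] by simp
qed

lemma tapp2_zero_left: "X \<in> vector_fields M \<Longrightarrow> tapp2 g 0 X = 0"
proof
  show "tapp2 g 0 X p = 0 p" if "X \<in> vector_fields M" for p
    using that by (cases "p \<in> points M")
      (simp_all add: tapp2_def metric_zero_left metric_off_points vector_field_tangent)
qed

lemma tapp2_commute:
  "X \<in> vector_fields M \<Longrightarrow> Y \<in> vector_fields M \<Longrightarrow> tapp2 g X Y = tapp2 g Y X"
proof
  show "tapp2 g X Y p = tapp2 g Y X p" if "X \<in> vector_fields M" "Y \<in> vector_fields M" for p
    using that by (cases "p \<in> points M")
      (simp_all add: tapp2_def metric_sym metric_off_points vector_field_tangent)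
qed

lemma tapp2_diff_left:
  assumes "X \<in> vector_fields M" "Y \<in> vector_fields M" "Z \<in> vector_fields M"
  shows "tapp2 g (X - Y) Z = tapp2 g X Z - tapp2 g Y Z"
proof
  show "tapp2 g (X - Y) Z p = (tapp2 g X Z - tapp2 g Y Z) p" for p
    using assms by (cases "p \<in> points M")
      (simp_all add: tapp2_def metric_diff_left metric_off_points vector_field_tangent)
qed

lemma tapp2_phi:
  assumes "X \<in> vector_fields M" "Y \<in> vector_fields M"
  shows "tapp2 g (tapp \<phi> X) Y = tapp2 g X (tapp \<phi> Y)"
proof
  show "tapp2 g (tapp \<phi> X) Y p = tapp2 g X (tapp \<phi> Y) p" for p
    using assms by (cases "p \<in> points M")
      (simp_all add: tapp2_def tapp_def phi_self_adjoint metric_off_points vector_field_tangent)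
qed

lemma tapp_phi_diff:
  assumes "X \<in> vector_fields M" "Y \<in> vector_fields M"
  shows "tapp \<phi> (X - Y) = tapp \<phi> X - tapp \<phi> Y"
proof (rule vector_field_eqI)
  show "tapp \<phi> (X - Y) \<in> vector_fields M" "tapp \<phi> X - tapp \<phi> Y \<in> vector_fields M"
    using assms by (simp_all add: phi_closed vector_fields_diff manifold)
  show "tapp \<phi> (X - Y) p = (tapp \<phi> X - tapp \<phi> Y) p" if "p \<in> points M" for p
    using assms that by (simp add: tapp_def phi_diff vector_field_tangent)
qed

lemma cov_tensor11_closed:
  assumes "affine_connection M D" "X \<in> vector_fields M" "Y \<in> vector_fields M"
  shows "cov_tensor11 D \<phi> X Y \<in> vector_fields M"
  using assms
  by (simp add: cov_tensor11_def phi_closed affine_connection_closed vector_fields_diff manifold)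

section \<open>Reduction of naturality to \<open>\<phi>\<close> and \<open>g\<close>\<close>

lemma parallel_xi:
  assumes D: "affine_connection M D" and X: "X \<in> vector_fields M"
    and phi: "cov_tensor11 D \<phi> X \<xi> = 0" and g: "cov_metric D g X \<xi> \<xi> = 0"
  shows "D X \<xi> = 0"
proof (rule vector_field_eqI)
  show V: "D X \<xi> \<in> vector_fields M"
    using D X field by (rule affine_connection_closed)
  show "0 \<in> vector_fields M"
    using manifold field by (rule vector_fields_zero)
  fix p assume p: "p \<in> points M"
  note T = vector_field_tangent[OF V p]
  have "tapp \<phi> (D X \<xi>) = 0"
    using phi affine_connection_zero[OF manifold D X] by (simp add: cov_tensor11_def tapp_phi_xi)
  then have "\<phi> p (D X \<xi> p) = 0"
    by (simp add: tapp_def fun_eq_iff)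
  \<comment> \<open>Here \<open>\<phi> p 0 = 0\<close> comes from applying \<open>\<phi> p\<close>
    to a vector minus itself. The formula for the square of \<open>\<phi>\<close> then leaves only
    the \<open>\<xi>\<close> component of \<open>D X \<xi> p\<close>.\<close>
  then have "\<phi> p (\<phi> p (D X \<xi> p)) = 0"
    using phi_diff[OF p T T] by simp
  moreover have "\<eta> p (D X \<xi> p) = 0"
  proof -
    \<comment> \<open>The constant \<open>tapp \<eta> \<xi>\<close> equals
      \<open>tapp2 g \<xi> \<xi>\<close>, whose derivative is, by metric compatibility and symmetry,
      twice \<open>\<eta> p (D X \<xi> p)\<close>.\<close>
    have "vf_deriv X (tapp \<eta> \<xi>) p = 0"
      using form field X p by (intro vf_deriv_one) (auto simp: one_form_def tapp_def eta_xi)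
    then have "tapp2 g (D X \<xi>) \<xi> p + tapp2 g \<xi> (D X \<xi>) p = 0"
      using fun_cong[OF g, of p] by (simp add: cov_metric_def tapp_eta field)
    then show ?thesis
      by (simp add: tapp2_def metric_sym[OF p T xi_tangent[OF p]] metric_xi[OF p T])
  qed
  ultimately show "D X \<xi> p = 0 p"
    using phi_phi[OF p T] by simp
qed

lemma parallel_eta:
  assumes "affine_connection M D" "X \<in> vector_fields M" "Y \<in> vector_fields M"
    and "D X \<xi> = 0" "cov_metric D g X \<xi> Y = 0"
  shows "cov_one_form D \<eta> X Y = 0"
  using assms
  by (simp add: cov_one_form_def cov_metric_def tapp_eta affine_connection_closed tapp2_zero_left)

lemma natural_connection_iff:
  assumes D: "affine_connection M D"
  shows "natural_connection M \<phi> \<xi> \<eta> g D \<longleftrightarrow>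
    (\<forall>X\<in>vector_fields M. \<forall>Y\<in>vector_fields M. cov_tensor11 D \<phi> X Y = 0) \<and>
    (\<forall>X\<in>vector_fields M. \<forall>Y\<in>vector_fields M. \<forall>Z\<in>vector_fields M. cov_metric D g X Y Z = 0)"
  using D field parallel_xi[OF D] parallel_eta[OF D] unfolding natural_connection_def by blast

section \<open>The two conditions on the potential\<close>

text \<open>Replacing \<open>nabla\<close> by \<open>D\<close> changes the covariant derivative of
  \<open>\<phi>\<close> by \<open>Q x (tapp \<phi> y) - tapp \<phi> (Q x y)\<close>; when this is
  paired with \<open>z\<close>, self-adjointness moves the outer \<open>\<phi>\<close> onto
  \<open>z\<close>.\<close>

lemma potential_phi:
  assumes "affine_connection M D" "affine_connection M nabla"
    and "x \<in> vector_fields M" "y \<in> vector_fields M" "z \<in> vector_fields M"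
    and Q: "\<And>x y. x \<in> vector_fields M \<Longrightarrow> y \<in> vector_fields M \<Longrightarrow> Q x y = D x y - nabla x y"
  shows "fundamental_tensor g nabla \<phi> x y z
      - (lower3 g Q x y (tapp \<phi> z) - lower3 g Q x (tapp \<phi> y) z)
    = tapp2 g (cov_tensor11 D \<phi> x y) z"
  using assms(1-5)
  by (simp add: fundamental_tensor_def lower3_def cov_tensor11_def Q tapp2_phi[symmetric]
      tapp_phi_diff tapp2_diff_left phi_closed affine_connection_closed vector_fields_diff manifold)

text \<open>The derivative of \<open>tapp2 g y z\<close> along \<open>x\<close> is common to both
  covariant derivatives and cancels.\<close>

lemma potential_metric:
  assumes "affine_connection M D" "affine_connection M nabla"
    and "x \<in> vector_fields M" "y \<in> vector_fields M" "z \<in> vector_fields M"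
    and Q: "\<And>x y. x \<in> vector_fields M \<Longrightarrow> y \<in> vector_fields M \<Longrightarrow> Q x y = D x y - nabla x y"
  shows "lower3 g Q x y z + lower3 g Q x z y = cov_metric nabla g x y z - cov_metric D g x y z"
  using assms(1-5)
  by (simp add: lower3_def cov_metric_def Q tapp2_diff_left tapp2_commute[of y]
      affine_connection_closed)

end

theorem proposition3p2:
  fixes M :: "('a, 'e::euclidean_space) mfd"
    and n :: nat
    and \<phi> :: "'a \<Rightarrow> 'a tangent \<Rightarrow> 'a tangent"
    and \<xi> :: "'a vfield"
    and \<eta> :: "'a \<Rightarrow> 'a tangent \<Rightarrow> real"
    and g :: "'a \<Rightarrow> 'a tangent \<Rightarrow> 'a tangent \<Rightarrow> real"
    and nabla D Q :: "'a vfield \<Rightarrow> 'a vfield \<Rightarrow> 'a vfield"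
  assumes "riemannian_Pi_manifold M n \<phi> \<xi> \<eta> g"
    and "levi_civita M g nabla"
    and "affine_connection M D"
    and "\<And>x y. x \<in> vector_fields M \<Longrightarrow> y \<in> vector_fields M \<Longrightarrow> D x y = nabla x y + Q x y"
  shows "natural_connection M \<phi> \<xi> \<eta> g D \<longleftrightarrow>
    (\<forall>x\<in>vector_fields M. \<forall>y\<in>vector_fields M. \<forall>z\<in>vector_fields M.
       lower3 g Q x y (tapp \<phi> z) - lower3 g Q x (tapp \<phi> y) z = fundamental_tensor g nabla \<phi> x y z \<and>
       lower3 g Q x y z = - lower3 g Q x z y)"
proof -
  interpret riemannian_Pi_manifold M n \<phi> \<xi> \<eta> g by fact
  let ?V = "vector_fields M"
  have nabla: "affine_connection M nabla"
    using assms(2) by (simp add: levi_civita_def)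
  have Q: "Q x y = D x y - nabla x y" if "x \<in> ?V" "y \<in> ?V" for x y
    using assms(4)[OF that] by simp
  have phi: "cov_tensor11 D \<phi> x y = 0 \<longleftrightarrow> (\<forall>z\<in>?V.
      lower3 g Q x y (tapp \<phi> z) - lower3 g Q x (tapp \<phi> y) z = fundamental_tensor g nabla \<phi> x y z)"
    if "x \<in> ?V" "y \<in> ?V" for x y
  proof -
    \<comment> \<open>Nondegeneracy of \<open>g\<close> trades an equation between fields for scalar
      equations in \<open>z\<close>.\<close>
    have "cov_tensor11 D \<phi> x y = 0 \<longleftrightarrow> (\<forall>z\<in>?V. tapp2 g (cov_tensor11 D \<phi> x y) z = 0)"
      using metric_zero_field[OF cov_tensor11_closed[OF assms(3) that]] tapp2_zero_left by auto
    also have "\<dots> \<longleftrightarrow> (\<forall>z\<in>?V.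
      lower3 g Q x y (tapp \<phi> z) - lower3 g Q x (tapp \<phi> y) z = fundamental_tensor g nabla \<phi> x y z)"
      using potential_phi[OF assms(3) nabla that _ Q] by (metis eq_iff_diff_eq_0)
    finally show ?thesis .
  qed
  have metric: "cov_metric D g x y z = 0 \<longleftrightarrow> lower3 g Q x y z = - lower3 g Q x z y"
    if "x \<in> ?V" "y \<in> ?V" "z \<in> ?V" for x y z
  proof -
    \<comment> \<open>Metric compatibility of \<open>nabla\<close> leaves the derivative of
      \<open>g\<close> under \<open>D\<close> as the obstruction to skew-symmetry of
      \<open>Q\<close> in its last two arguments.\<close>
    have "cov_metric nabla g x y z = 0"
      using assms(2) that by (simp add: levi_civita_def)
    then have "lower3 g Q x y z + lower3 g Q x z y = - cov_metric D g x y z"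
      using potential_metric[OF assms(3) nabla that Q] by simp
    then show ?thesis
      by (metis eq_neg_iff_add_eq_0 neg_equal_0_iff_equal)
  qed
  show ?thesis
    unfolding natural_connection_iff[OF assms(3)] using phi metric by blast
qed

end
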